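(* Let $K$ be a field of characteristic zero and let $f\in K[x]$ be a monic nonscalar polynomial. Then $$\mathrm{Aut}_K(\Lambda(f))=\mathbb{S}(K)\rtimes G_f(K),$$ i.e. the group of $K$-algebra automorphisms of $\Lambda(f)=K[x][y; f\frac{d}{dx}]$ is the semidirect product of its normal subgroup $\mathbb{S}(K)$ and its subgroup $G_f(K)$ (the eigengroup of $f$, identified with a subgroup of $\mathrm{Aut}_K(\Lambda(f))$ as described in the context).
   Context: $K$ is a field of characteristic zero and $K^\times=K\setminus\{0\}$. For $f\in K[x]$, $\Lambda(f)=K[x][y; f\frac{d}{dx}]=K\langle x,y\mid yx-xy=f\rangle=\bigoplus_{i\ge 0}K[x]y^i$ is the Ore extension of $K[x]$. For $p\in K[x]$ let $s_p$ be the $K$-automorphism of $\Lambda(f)$ with $s_p(x)=x$, $s_p(y)=y+p$. Put $\mathbb{S}(K)=\{s_p\mid p\in K[x]\}$, a subgroup of $\mathrm{Aut}_K(\Lambda(f))$ isomorphic to $(K[x],+)$ via $s_p\mapsto p$. For $\lambda\in K^\times$, $\mu\in K$ let $\sigma_{\lambda,\mu}\in\mathrm{Aut}_K(K[x])$ be given by $\sigma_{\lambda,\mu}(x)=\lambda x+\mu$; these are all the elements of $\mathrm{Aut}_K(K[x])$. The eigengroup of $f$ is $G_f(K)=\{\sigma\in\mathrm{Aut}_K(K[x])\mid \sigma(f)=cf\text{ for some }c\in K\}$. Let $d=\deg f\ge 1$. The group $G_f(K)$ is identified with its image in $\mathrm{Aut}_K(\Lambda(f))$ under the group monomorphism sending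 $\sigma_{\lambda,\mu}\in G_f(K)$ to the automorphism $x\mapsto\lambda x+\mu$, $y\mapsto\lambda^{d-1}y$. A group $G$ is the semidirect product $N\rtimes H$ of a normal subgroup $N$ and a subgroup $H$ if $G=NH$ and $N\cap H=\{e\}$. *)

theory Defs
  imports
    "HOL-Computational_Algebra.Polynomial"
    "HOL-Algebra.Coset"
    "HOL-Algebra.Bij"
    "HOL-Algebra.Ring"
begin

section \<open>Ore extensions of derivation type\<close>

text \<open>
  The underlying left module of \<open>R[y; \<delta>]\<close> is the free module \<open>\<Oplus>\<^sub>i R y\<^sup>i\<close>; the element
  \<open>\<Sum>\<^sub>i a\<^sub>i y\<^sup>i\<close> (coefficients on the left) is represented by the polynomial with coefficients
  \<open>a\<^sub>i\<close>.  Left multiplication by \<open>y\<close> is given by \<open>y (b y\<^sup>j) = b y\<^sup>j\<^sup>+\<^sup>1 + \<delta>(b) y\<^sup>j\<close>.  The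
  commutative product \<open>*\<close> of the type \<open>'r poly\<close> is not the product of \<open>R[y; \<delta>]\<close>.
\<close>

definition ore_y_times :: "('r::comm_ring_1 \<Rightarrow> 'r) \<Rightarrow> 'r poly \<Rightarrow> 'r poly" where
  "ore_y_times \<delta> q = pCons 0 q + map_poly \<delta> q"

definition ore_mult :: "('r::comm_ring_1 \<Rightarrow> 'r) \<Rightarrow> 'r poly \<Rightarrow> 'r poly \<Rightarrow> 'r poly" where
  "ore_mult \<delta> p q = (\<Sum>i\<le>degree p. smult (coeff p i) ((ore_y_times \<delta> ^^ i) q))"

definition ore_extension :: "('r::comm_ring_1 \<Rightarrow> 'r) \<Rightarrow> 'r poly ring" where
  "ore_extension \<delta> =
     \<lparr>carrier = UNIV, monoid.mult = ore_mult \<delta>, one = 1, zero = 0, add = (+)\<rparr>"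

definition ore_y :: "'r::comm_ring_1 poly" where
  "ore_y = [:0, 1:]"

text \<open>The map \<open>\<Sum>\<^sub>i a\<^sub>i y\<^sup>i \<mapsto> \<Sum>\<^sub>i \<sigma>(a\<^sub>i) w\<^sup>i\<close>, with products and powers taken in \<open>R[y; \<delta>]\<close>.\<close>

definition ore_subst ::
  "('r::comm_ring_1 \<Rightarrow> 'r) \<Rightarrow> ('r \<Rightarrow> 'r) \<Rightarrow> 'r poly \<Rightarrow> 'r poly \<Rightarrow> 'r poly" where
  "ore_subst \<delta> \<sigma> w u =
     (\<Sum>i\<le>degree u. [:\<sigma> (coeff u i):] \<otimes>\<^bsub>ore_extension \<delta>\<^esub> (w [^]\<^bsub>ore_extension \<delta>\<^esub> i))"

definition derivation :: "('r::comm_ring_1 \<Rightarrow> 'r) \<Rightarrow> bool" where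
  "derivation \<delta> \<longleftrightarrow> (\<forall>a b. \<delta> (a + b) = \<delta> a + \<delta> b) \<and> (\<forall>a b. \<delta> (a * b) = a * \<delta> b + \<delta> a * b)"

lemma derivation_0: "derivation \<delta> \<Longrightarrow> \<delta> 0 = 0"
  unfolding derivation_def by (metis add_cancel_right_left add_0)

lemma derivation_1: "derivation \<delta> \<Longrightarrow> \<delta> 1 = 0"
  unfolding derivation_def by (metis add_cancel_right_left mult_1 mult_1_right)

context
  fixes \<delta> :: "'r::comm_ring_1 \<Rightarrow> 'r"
  assumes der: "derivation \<delta>"
begin

lemma map_poly_derivation_pCons: "map_poly \<delta> (pCons a p) = pCons (\<delta> a) (map_poly \<delta> p)"
  by (rule map_poly_pCons) (rule derivation_0[OF der])

lemma ore_y_times_add: "ore_y_times \<delta> (p + q) = ore_y_times \<delta> p + ore_y_times \<delta> q"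
  using der derivation_0[OF der]
  by (auto intro!: poly_eqI
      simp: ore_y_times_def derivation_def coeff_map_poly coeff_pCons split: nat.split)

lemma ore_y_times_smult:
  "ore_y_times \<delta> (smult a q) = smult a (ore_y_times \<delta> q) + smult (\<delta> a) q"
  using der derivation_0[OF der]
  by (auto intro!: poly_eqI
      simp: ore_y_times_def derivation_def coeff_map_poly coeff_pCons algebra_simps split: nat.split)

lemma ore_y_times_0: "ore_y_times \<delta> 0 = 0"
  by (simp add: ore_y_times_def)

lemma ore_y_times_pow_add:
  "(ore_y_times \<delta> ^^ i) (p + q) = (ore_y_times \<delta> ^^ i) p + (ore_y_times \<delta> ^^ i) q"
  by (induction i) (simp_all add: ore_y_times_add)

lemma ore_mult_bound:
  assumes "degree p \<le> n"
  shows "ore_mult \<delta> p q = (\<Sum>i\<le>n. smult (coeff p i) ((ore_y_times \<delta> ^^ i) q))"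
  unfolding ore_mult_def using assms
  by (intro sum.mono_neutral_left) (auto simp: coeff_eq_0 not_le)

lemma ore_mult_add_left: "ore_mult \<delta> (p + q) r = ore_mult \<delta> p r + ore_mult \<delta> q r"
proof -
  let ?n = "max (degree p) (degree q)"
  have "degree (p + q) \<le> ?n" by (rule degree_add_le_max)
  then show ?thesis
    by (simp add: ore_mult_bound[of _ ?n] smult_add_left sum.distrib)
qed

lemma ore_mult_add_right: "ore_mult \<delta> p (q + r) = ore_mult \<delta> p q + ore_mult \<delta> p r"
  by (simp add: ore_mult_def ore_y_times_pow_add smult_add_right sum.distrib)

lemma smult_sum_right: "smult a (sum g A) = (\<Sum>i\<in>A. smult a (g i))"
  by (induction A rule: infinite_finite_induct) (simp_all add: smult_add_right)

lemma ore_mult_0_left: "ore_mult \<delta> 0 q = 0"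
  by (simp add: ore_mult_def)

lemma ore_mult_const_left: "ore_mult \<delta> [:a:] q = smult a q"
  by (simp add: ore_mult_def)

lemma ore_mult_smult_left: "ore_mult \<delta> (smult a p) q = smult a (ore_mult \<delta> p q)"
  by (simp add: ore_mult_bound[of _ "degree p"] degree_smult_le smult_sum_right)

lemma ore_mult_pCons:
  "ore_mult \<delta> (pCons a p) q = smult a q + ore_mult \<delta> p (ore_y_times \<delta> q)"
proof -
  have "ore_mult \<delta> (pCons a p) q
      = (\<Sum>i\<le>Suc (degree p). smult (coeff (pCons a p) i) ((ore_y_times \<delta> ^^ i) q))"
    by (rule ore_mult_bound) (rule degree_pCons_le)
  also have "\<dots> = smult a q + ore_mult \<delta> p (ore_y_times \<delta> q)"
    unfolding sum.atMost_Suc_shift by (simp add: ore_mult_def funpow_swap1)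
  finally show ?thesis .
qed

lemma ore_mult_y_times: "ore_mult \<delta> (ore_y_times \<delta> p) q = ore_y_times \<delta> (ore_mult \<delta> p q)"
proof (induction p arbitrary: q)
  case 0
  then show ?case by (simp add: ore_y_times_0 ore_mult_0_left)
next
  case (pCons a p)
  have "ore_y_times \<delta> (pCons a p) = [:\<delta> a, a:] + pCons 0 (ore_y_times \<delta> p)"
    by (simp add: ore_y_times_def map_poly_derivation_pCons)
  then show ?case
    by (simp add: ore_mult_pCons ore_mult_add_left ore_mult_0_left pCons.IH
        ore_y_times_add ore_y_times_smult)
qed

lemma ore_mult_assoc: "ore_mult \<delta> (ore_mult \<delta> p q) r = ore_mult \<delta> p (ore_mult \<delta> q r)"
  by (induction p arbitrary: q)
    (simp_all add: ore_mult_0_left ore_mult_pCons ore_mult_add_left ore_mult_smult_left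
      ore_mult_y_times)

lemma ore_mult_y_left: "ore_mult \<delta> ore_y q = ore_y_times \<delta> q"
  by (simp add: ore_y_def ore_mult_pCons ore_mult_0_left)

lemma ore_mult_1_left: "ore_mult \<delta> 1 q = q"
  by (simp add: ore_mult_const_left one_pCons)

lemma ore_mult_monom_right: "ore_mult \<delta> p (monom 1 k) = monom 1 k * p"
proof (induction p arbitrary: k)
  case 0
  then show ?case by (simp add: ore_mult_0_left)
next
  case (pCons a p)
  have "map_poly \<delta> (monom 1 k) = 0"
    using derivation_0[OF der] derivation_1[OF der] by (auto intro!: poly_eqI simp: coeff_map_poly)
  then have "ore_y_times \<delta> (monom 1 k) = monom 1 (Suc k)"
    by (simp add: ore_y_times_def monom_Suc)
  then show ?case
    using pCons.IH[of "Suc k"] by (simp add: ore_mult_pCons monom_Suc)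
qed

lemma ore_mult_1_right: "ore_mult \<delta> p 1 = p"
  using ore_mult_monom_right[of p 0] by simp

lemma ring_ore_extension: "ring (ore_extension \<delta>)"
proof (rule ringI)
  show "abelian_group (ore_extension \<delta>)"
  proof (rule abelian_groupI)
    fix p assume "p \<in> carrier (ore_extension \<delta>)"
    have "- p + p = 0" by simp
    then show "\<exists>q\<in>carrier (ore_extension \<delta>). q \<oplus>\<^bsub>ore_extension \<delta>\<^esub> p = \<zero>\<^bsub>ore_extension \<delta>\<^esub>"
      by (auto simp: ore_extension_def intro!: exI[of _ "- p"])
  qed (auto simp: ore_extension_def algebra_simps)
  show "monoid (ore_extension \<delta>)"
    by (rule monoidI)
      (auto simp: ore_extension_def ore_mult_assoc ore_mult_1_left ore_mult_1_right)
qed (auto simp: ore_extension_def ore_mult_add_left ore_mult_add_right)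

lemma ore_y_commutation:
  "ore_y \<otimes>\<^bsub>ore_extension \<delta>\<^esub> [:a:] = [:a:] \<otimes>\<^bsub>ore_extension \<delta>\<^esub> ore_y + [:\<delta> a:]"
  using ore_mult_y_left[of "[:a:]"]
  by (simp add: ore_extension_def ore_mult_const_left ore_y_times_def
      map_poly_derivation_pCons ore_y_def)

lemma ore_extension_pow_1: "w [^]\<^bsub>ore_extension \<delta>\<^esub> Suc 0 = w"
  using monoid.nat_pow_Suc[OF ring.is_monoid[OF ring_ore_extension]]
    monoid.nat_pow_0[OF ring.is_monoid[OF ring_ore_extension]]
  by (simp add: nat_pow_def ore_extension_def ore_mult_1_left)

lemma ore_subst_const: "ore_subst \<delta> \<sigma> w [:a:] = [:\<sigma> a:]"
  by (simp add: ore_subst_def ore_extension_def nat_pow_def ore_mult_1_right)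

lemma ore_subst_y:
  assumes "\<sigma> 0 = 0" "\<sigma> 1 = 1"
  shows "ore_subst \<delta> \<sigma> w ore_y = w"
  using assms ore_extension_pow_1[of w]
  by (simp add: ore_subst_def ore_y_def)
    (simp add: ore_extension_def ore_mult_0_left ore_mult_1_left flip: one_pCons)

end

section \<open>Automorphism groups of algebras\<close>

text \<open>A \<open>K\<close>-algebra is given by a ring \<open>R\<close> together with its structure map \<open>\<iota>\<close> from \<open>K\<close> to \<open>R\<close>.\<close>

definition alg_auto :: "('k \<Rightarrow> 'b) \<Rightarrow> ('b, 'm) ring_scheme \<Rightarrow> ('b \<Rightarrow> 'b) set" where
  "alg_auto \<iota> R = {\<phi> \<in> ring_hom R R \<inter> Bij (carrier R). \<forall>c. \<phi> (\<iota> c) = \<iota> c}"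

definition alg_AutoGroup :: "('k \<Rightarrow> 'b) \<Rightarrow> ('b, 'm) ring_scheme \<Rightarrow> ('b \<Rightarrow> 'b) monoid" where
  "alg_AutoGroup \<iota> R = BijGroup (carrier R) \<lparr>carrier := alg_auto \<iota> R\<rparr>"

definition semidirect_product :: "('g, 'm) monoid_scheme \<Rightarrow> 'g set \<Rightarrow> 'g set \<Rightarrow> bool" where
  "semidirect_product G N H \<longleftrightarrow>
     normal N G \<and> subgroup H G \<and> N <#>\<^bsub>G\<^esub> H = carrier G \<and> N \<inter> H = {\<one>\<^bsub>G\<^esub>}"

section \<open>The algebra \<open>\<Lambda>(f) = K[x][y; f d/dx]\<close> and its automorphisms\<close>

definition f_ddx :: "'a::field_char_0 poly \<Rightarrow> 'a poly \<Rightarrow> 'a poly" where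
  "f_ddx f a = f * pderiv a"

lemma derivation_f_ddx: "derivation (f_ddx f)"
  by (simp add: derivation_def f_ddx_def pderiv_add pderiv_mult algebra_simps)

definition Lambda :: "'a::field_char_0 poly \<Rightarrow> 'a poly poly ring" where
  "Lambda f = ore_extension (f_ddx f)"

definition Aut_Lambda ::
  "'a::field_char_0 poly \<Rightarrow> ('a poly poly \<Rightarrow> 'a poly poly) monoid" where
  "Aut_Lambda f = alg_AutoGroup (\<lambda>c. [:[:c:]:]) (Lambda f)"

abbreviation gen_x :: "'a::field_char_0 poly" where
  "gen_x \<equiv> [:0, 1:]"

lemma ring_Lambda: "ring (Lambda f)"
  unfolding Lambda_def by (rule ring_ore_extension[OF derivation_f_ddx])

lemma Lambda_relation:
  "ore_y \<otimes>\<^bsub>Lambda f\<^esub> [:gen_x:] - [:gen_x:] \<otimes>\<^bsub>Lambda f\<^esub> ore_y = [:f:]"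
  by (simp add: Lambda_def ore_y_commutation[OF derivation_f_ddx] f_ddx_def pderiv_pCons)

definition s_aut ::
  "'a::field_char_0 poly \<Rightarrow> 'a poly \<Rightarrow> 'a poly poly \<Rightarrow> 'a poly poly" where
  "s_aut f p = ore_subst (f_ddx f) (\<lambda>a. a) (ore_y + [:p:])"

lemma s_aut_generators:
  "s_aut f p [:gen_x:] = [:gen_x:]"
  "s_aut f p ore_y = ore_y + [:p:]"
  by (simp_all add: s_aut_def ore_subst_const[OF derivation_f_ddx]
      ore_subst_y[OF derivation_f_ddx])

definition S_group :: "'a::field_char_0 poly \<Rightarrow> ('a poly poly \<Rightarrow> 'a poly poly) set" where
  "S_group f = range (s_aut f)"

definition poly_alg :: "'a::field_char_0 poly ring" where
  "poly_alg = \<lparr>carrier = UNIV, monoid.mult = (*), one = 1, zero = 0, add = (+)\<rparr>"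

definition Aut_poly :: "('a::field_char_0 poly \<Rightarrow> 'a poly) monoid" where
  "Aut_poly = alg_AutoGroup (\<lambda>c. [:c:]) poly_alg"

definition eigengroup :: "'a::field_char_0 poly \<Rightarrow> ('a poly \<Rightarrow> 'a poly) set" where
  "eigengroup f = {\<sigma> \<in> carrier Aut_poly. \<exists>c. \<sigma> f = smult c f}"

text \<open>
  If \<open>\<sigma>(x) = \<lambda> x + \<mu>\<close>, then \<open>\<lambda>\<close> is the coefficient of \<open>x\<close> in \<open>\<sigma>(x)\<close>, and the automorphism of
  \<open>\<Lambda>(f)\<close> attached to \<open>\<sigma>\<close> restricts to \<open>\<sigma>\<close> on \<open>K[x]\<close> and maps \<open>y\<close> to \<open>\<lambda>\<^sup>d\<^sup>-\<^sup>1 y\<close>.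
\<close>

definition eigen_embed ::
  "'a::field_char_0 poly \<Rightarrow> ('a poly \<Rightarrow> 'a poly) \<Rightarrow> 'a poly poly \<Rightarrow> 'a poly poly" where
  "eigen_embed f \<sigma> =
     ore_subst (f_ddx f) \<sigma> (smult [:coeff (\<sigma> gen_x) 1 ^ (degree f - 1):] ore_y)"

definition sigma_aut :: "'a::field_char_0 \<Rightarrow> 'a \<Rightarrow> 'a poly \<Rightarrow> 'a poly" where
  "sigma_aut lam mu a = pcompose a [:mu, lam:]"

lemma eigen_embed_sigma_generators:
  "eigen_embed f (sigma_aut lam mu) [:gen_x:] = [:[:mu, lam:]:]"
  "eigen_embed f (sigma_aut lam mu) ore_y = smult [:lam ^ (degree f - 1):] ore_y"
  by (simp_all add: eigen_embed_def sigma_aut_def ore_subst_const[OF derivation_f_ddx]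
      ore_subst_y[OF derivation_f_ddx] pcompose_pCons pcompose_1)

lemma sigma_aut_inverse:
  assumes "lam \<noteq> 0"
  shows "sigma_aut lam mu (sigma_aut (1 / lam) (- mu / lam) a) = a"
    and "sigma_aut (1 / lam) (- mu / lam) (sigma_aut lam mu a) = a"
  using assms by (simp_all add: sigma_aut_def pcompose_pCons flip: pcompose_assoc)

lemma carrier_Aut_poly: "carrier Aut_poly = {sigma_aut lam mu | lam mu. lam \<noteq> 0}"
proof (intro equalityI subsetI)
  fix \<sigma> :: "'a poly \<Rightarrow> 'a poly"
  assume "\<sigma> \<in> {sigma_aut lam mu | lam mu. lam \<noteq> 0}"
  then obtain lam mu where l: "lam \<noteq> 0" and \<sigma>: "\<sigma> = sigma_aut lam mu" by blast
  have "bij \<sigma>"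
    unfolding \<sigma> using sigma_aut_inverse[OF l]
    by (intro o_bij[of "sigma_aut (1 / lam) (- mu / lam)"]) (auto simp: fun_eq_iff)
  then show "\<sigma> \<in> carrier Aut_poly"
    by (auto simp: Aut_poly_def alg_AutoGroup_def alg_auto_def poly_alg_def ring_hom_def Bij_def
        \<sigma> sigma_aut_def pcompose_mult pcompose_add pcompose_1)
next
  fix \<sigma> :: "'a poly \<Rightarrow> 'a poly"
  assume "\<sigma> \<in> carrier Aut_poly"
  then have hom: "\<sigma> (a + b) = \<sigma> a + \<sigma> b" "\<sigma> (a * b) = \<sigma> a * \<sigma> b" "\<sigma> [:c:] = [:c:]"
    and bij: "bij \<sigma>" for a b c
    by (auto simp: Aut_poly_def alg_AutoGroup_def alg_auto_def poly_alg_def ring_hom_def Bij_def)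
  have \<sigma>: "\<sigma> a = pcompose a (\<sigma> gen_x)" for a
  proof (induction a)
    case 0
    then show ?case using hom(3)[of 0] by simp
  next
    case (pCons c a)
    have "pCons c a = [:c:] + gen_x * a" by simp
    then show ?case using pCons.IH by (simp only: hom pcompose_pCons)
        (simp add: pcompose_pCons)
  qed
  obtain b where b: "\<sigma> b = gen_x" using bij by (metis bij_pointE)
  have "degree b * degree (\<sigma> gen_x) = 1"
    using \<sigma>[of b] b by (metis degree_pcompose degree_pCons_eq_if one_neq_zero degree_0 pCons_eq_0_iff One_nat_def)
  then have d: "degree (\<sigma> gen_x) = 1" by simp
  define lam where "lam = coeff (\<sigma> gen_x) 1"
  define mu where "mu = coeff (\<sigma> gen_x) 0"
  have x: "\<sigma> gen_x = [:mu, lam:]"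
    using d by (auto intro!: poly_eqI simp: lam_def mu_def coeff_pCons coeff_eq_0 split: nat.split)
  have "lam \<noteq> 0"
    using d by (metis lam_def leading_coeff_0_iff degree_0 zero_neq_one)
  then show "\<sigma> \<in> {sigma_aut lam mu | lam mu. lam \<noteq> 0}"
    using \<sigma> unfolding x by (auto simp: sigma_aut_def fun_eq_iff)
qed

definition G_group :: "'a::field_char_0 poly \<Rightarrow> ('a poly poly \<Rightarrow> 'a poly poly) set" where
  "G_group f = eigen_embed f ` eigengroup f"

end

theory Submission
  imports Defs
begin

text \<open>
  Commutators in \<open>\<Lambda>(f)\<close> lie in \<open>f \<Lambda>(f)\<close>, because modulo \<open>f\<close> the product is commutative.  Hence an
  automorphism \<open>\<phi>\<close> maps \<open>f = [y, x]\<close> to \<open>f u\<close>, and applying the same to \<open>\<phi>\<^sup>-\<^sup>1\<close> shows that \<open>u\<close> is a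
  unit, i.e. a nonzero scalar.  Comparing degrees in \<open>y\<close> gives \<open>\<phi>(x) \<in> K[x]\<close>, so \<open>\<phi>(x) = \<lambda> x + \<mu>\<close>,
  and then the relation \<open>[\<phi>(y), \<phi>(x)] = \<lambda>\<^sup>d f\<close> forces \<open>\<phi>(y) = \<lambda>\<^sup>d\<^sup>-\<^sup>1 y + b\<close> with \<open>b \<in> K[x]\<close>.
  Consequently \<open>\<S>(K)\<close> consists of the automorphisms fixing \<open>x\<close>, and \<open>G\<^sub>f(K)\<close> of those mapping \<open>y\<close>
  to a scalar multiple of \<open>y\<close>.
\<close>

section \<open>Degrees and commutators in Ore extensions\<close>

context
  fixes \<delta> :: "'r::comm_ring_1 \<Rightarrow> 'r"
  assumes der: "derivation \<delta>"
begin

lemma coeff_ore_y_times: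
  "coeff (ore_y_times \<delta> q) n = (case n of 0 \<Rightarrow> 0 | Suc m \<Rightarrow> coeff q m) + \<delta> (coeff q n)"
  by (simp add: ore_y_times_def coeff_map_poly derivation_0[OF der] coeff_pCons)

lemma degree_ore_y_times_le:
  assumes "degree q \<le> n"
  shows "degree (ore_y_times \<delta> q) \<le> Suc n"
  using assms by (intro degree_le)
    (auto simp: coeff_ore_y_times coeff_eq_0 derivation_0[OF der] split: nat.split)

text \<open>Leading coefficients multiply as for ordinary polynomials because \<delta> does not
  raise the degree in y. Bounds \<open>m\<close>, \<open>n\<close> in place of exact degrees let the
  induction pass from \<open>q\<close> to y q with bound n + 1.\<close>

lemma ore_mult_degree_coeff:
  assumes "degree p \<le> m" "degree q \<le> n"
  shows "degree (ore_mult \<delta> p q) \<le> m + n"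
    and "coeff (ore_mult \<delta> p q) (m + n) = coeff p m * coeff q n"
proof -
  have "degree (ore_mult \<delta> p q) \<le> m + n \<and>
      coeff (ore_mult \<delta> p q) (m + n) = coeff p m * coeff q n"
    using assms
  proof (induction p arbitrary: m n q)
    case 0
    then show ?case by (simp add: ore_mult_0_left[OF der])
  next
    case (pCons a p)
    show ?case
    proof (cases m)
      case 0
      with pCons.hyps pCons.prems have "p = 0" by (auto split: if_splits)
      with 0 pCons.prems show ?thesis
        by (simp add: ore_mult_const_left[OF der] degree_smult_le[THEN order_trans])
    next
      case (Suc k)
      have p: "degree p \<le> k"
        using pCons.prems(1) Suc by (cases "p = 0") auto
      have "degree (ore_mult \<delta> p (ore_y_times \<delta> q)) \<le> k + Suc n"
        and c: "coeff (ore_mult \<delta> p (ore_y_times \<delta> q)) (k + Suc n)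
          = coeff p k * coeff (ore_y_times \<delta> q) (Suc n)"
        using pCons.IH[OF p degree_ore_y_times_le[OF pCons.prems(2)]] by auto
      moreover have "degree (smult a q) \<le> k + Suc n" "coeff (smult a q) (k + Suc n) = 0"
        "coeff q (Suc n) = 0"
        using pCons.prems(2) degree_smult_le[of a q] by (auto simp: coeff_eq_0)
      ultimately show ?thesis
        using Suc by (simp add: ore_mult_pCons[OF der] degree_add_le coeff_ore_y_times
            derivation_0[OF der])
    qed
  qed
  then show "degree (ore_mult \<delta> p q) \<le> m + n"
    and "coeff (ore_mult \<delta> p q) (m + n) = coeff p m * coeff q n" by auto
qed

text \<open>Since y^i g = g y^i + i \<delta>(g) y^(i-1) + lower terms, subtracting g w cancels the
  leading terms. This later determines \<phi>(y) from its commutator with \<phi>(x).\<close>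

lemma ore_mult_const_right_degree_coeff:
  assumes "degree w \<le> Suc n"
  shows "degree (ore_mult \<delta> w [:g:] - smult g w) \<le> n"
    and "coeff (ore_mult \<delta> w [:g:] - smult g w) n = of_nat (Suc n) * coeff w (Suc n) * \<delta> g"
proof -
  \<comment> \<open>The Leibniz formula truncated to its two top coefficients. The last conjunct
    imposes nothing at i = 0, where there is no second coefficient.\<close>
  have pow: "degree ((ore_y_times \<delta> ^^ i) [:g:]) \<le> i
      \<and> coeff ((ore_y_times \<delta> ^^ i) [:g:]) i = g
      \<and> (\<forall>j. i = Suc j \<longrightarrow> coeff ((ore_y_times \<delta> ^^ i) [:g:]) j = of_nat i * \<delta> g)" for i
  proof (induction i)
    case (Suc i)
    define Q where "Q = (ore_y_times \<delta> ^^ i) [:g:]"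
    have Q: "degree Q \<le> i" "coeff Q i = g" "coeff Q (Suc i) = 0"
      using Suc by (simp_all add: Q_def coeff_eq_0)
    have "(case i of 0 \<Rightarrow> 0 | Suc j \<Rightarrow> coeff Q j) = of_nat i * \<delta> g"
      using Suc by (simp add: Q_def split: nat.split)
    then have "coeff (ore_y_times \<delta> Q) i = of_nat (Suc i) * \<delta> g"
      by (simp add: coeff_ore_y_times Q distrib_right)
    moreover have "(ore_y_times \<delta> ^^ Suc i) [:g:] = ore_y_times \<delta> Q"
      by (simp add: Q_def)
    ultimately show ?case
      using Q by (simp add: degree_ore_y_times_le coeff_ore_y_times derivation_0[OF der]
          del: funpow.simps)
  qed simp
  have eq: "ore_mult \<delta> w [:g:] =
      (\<Sum>i\<le>Suc n. smult (coeff w i) ((ore_y_times \<delta> ^^ i) [:g:]))"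
    by (rule ore_mult_bound[OF der assms])
  have co: "coeff ((ore_y_times \<delta> ^^ i) [:g:]) j = (if j = i then g else 0)" if "i \<le> j" for i j
    using that pow[of i] by (auto simp: coeff_eq_0)
  have c: "coeff (ore_mult \<delta> w [:g:]) k =
      (\<Sum>i\<le>Suc n. coeff w i * coeff ((ore_y_times \<delta> ^^ i) [:g:]) k)" for k
    by (simp only: eq coeff_sum coeff_smult)
  show "degree (ore_mult \<delta> w [:g:] - smult g w) \<le> n"
  proof (rule degree_le, intro allI impI)
    fix k assume k: "n < k"
    have "coeff (ore_mult \<delta> w [:g:]) k = (\<Sum>i\<le>Suc n. if k = i then coeff w i * g else 0)"
      unfolding c using k by (intro sum.cong) (auto simp: co)
    also have "\<dots> = coeff w k * g"
      using assms k by (auto simp: coeff_eq_0)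
    finally show "coeff (ore_mult \<delta> w [:g:] - smult g w) k = 0"
      by (simp add: mult.commute)
  qed
  have "coeff (ore_mult \<delta> w [:g:]) n =
      (\<Sum>i\<le>n. if n = i then coeff w i * g else 0) + coeff w (Suc n) * (of_nat (Suc n) * \<delta> g)"
    unfolding c sum.atMost_Suc using pow[of "Suc n"]
    by (intro arg_cong2[of _ _ _ _ "(+)"] sum.cong) (auto simp: co)
  then show "coeff (ore_mult \<delta> w [:g:] - smult g w) n = of_nat (Suc n) * coeff w (Suc n) * \<delta> g"
    by (simp add: algebra_simps)
qed

lemma ore_mult_y_right: "ore_mult \<delta> p ore_y = pCons 0 p"
  using ore_mult_monom_right[OF der, of p 1] by (simp add: ore_y_def monom_altdef)

text \<open>Modulo f the derivation vanishes, so left multiplication by y is the plain shift and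
  \<open>ore_mult\<close> becomes the commutative \<open>*\<close>.\<close>

lemma ore_mult_cong_times:
  assumes "\<And>a. f dvd \<delta> a"
  shows "\<exists>r. ore_mult \<delta> p q = p * q + smult f r"
proof (induction p arbitrary: q)
  case 0
  then show ?case by (auto simp: ore_mult_0_left[OF der] intro: exI[of _ 0])
next
  case (pCons a p)
  obtain h where h: "\<And>b. \<delta> b = f * h b" using assms unfolding dvd_def by metis
  \<comment> \<open>\<open>coeff_map_poly\<close> needs value 0 at 0, which the choice of
    \<open>h\<close> does not guarantee.\<close>
  define s where "s = map_poly (\<lambda>b. if b = 0 then 0 else h b) q"
  have s: "map_poly \<delta> q = smult f s"
  proof (rule poly_eqI)
    fix n
    show "coeff (map_poly \<delta> q) n = coeff (smult f s) n"
      using h[of "coeff q n"] derivation_0[OF der] by (auto simp: s_def coeff_map_poly)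
  qed
  obtain r where "ore_mult \<delta> p (ore_y_times \<delta> q) = p * ore_y_times \<delta> q + smult f r"
    using pCons.IH by blast
  then have "ore_mult \<delta> (pCons a p) q = pCons a p * q + smult f (p * s + r)"
    by (simp add: ore_mult_pCons[OF der] ore_y_times_def s algebra_simps smult_add_right)
  then show ?case ..
qed

lemma ore_commutator_dvd:
  assumes "\<And>a. f dvd \<delta> a"
  obtains r where "ore_mult \<delta> p q - ore_mult \<delta> q p = smult f r"
proof -
  obtain r s where "ore_mult \<delta> p q = p * q + smult f r" "ore_mult \<delta> q p = q * p + smult f s"
    using ore_mult_cong_times[OF assms] by metis
  then have "ore_mult \<delta> p q - ore_mult \<delta> q p = smult f (r - s)"
    by (simp add: smult_diff_right)
  then show thesis by (rule that)
qed

end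

text \<open>Over a domain the product of the leading coefficients is nonzero, so the Ore extension
  is again a domain.\<close>

lemma degree_ore_mult:
  fixes \<delta> :: "'r::idom \<Rightarrow> 'r"
  assumes "derivation \<delta>" "p \<noteq> 0" "q \<noteq> 0"
  shows "ore_mult \<delta> p q \<noteq> 0" "degree (ore_mult \<delta> p q) = degree p + degree q"
proof -
  have "coeff (ore_mult \<delta> p q) (degree p + degree q) \<noteq> 0"
    using ore_mult_degree_coeff(2)[OF assms(1) order_refl order_refl, of p q] assms(2,3) by simp
  then show "ore_mult \<delta> p q \<noteq> 0" "degree (ore_mult \<delta> p q) = degree p + degree q"
    using ore_mult_degree_coeff(1)[OF assms(1) order_refl order_refl, of p q] le_degree
    by (fastforce intro: antisym)+
qed

section \<open>Homomorphisms out of Ore extensions\<close>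

context
  fixes \<delta> :: "'r::comm_ring_1 \<Rightarrow> 'r" and \<sigma> :: "'r \<Rightarrow> 'r" and w :: "'r poly"
  assumes der: "derivation \<delta>"
    and \<sigma>_add: "\<And>a b. \<sigma> (a + b) = \<sigma> a + \<sigma> b"
    and \<sigma>_mult: "\<And>a b. \<sigma> (a * b) = \<sigma> a * \<sigma> b"
    and comm: "\<And>a. ore_mult \<delta> w [:\<sigma> a:] = smult (\<sigma> a) w + [:\<sigma> (\<delta> a):]"
begin

lemma ore_subst_bound:
  assumes "degree u \<le> n"
  shows "ore_subst \<delta> \<sigma> w u = (\<Sum>i\<le>n. smult (\<sigma> (coeff u i)) (w [^]\<^bsub>ore_extension \<delta>\<^esub> i))"
proof -
  have "\<sigma> 0 = 0" using \<sigma>_add[of 0 0] by simp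
  then show ?thesis
    using assms unfolding ore_subst_def
    by (intro sum.mono_neutral_cong_left)
      (auto simp: coeff_eq_0 ore_mult_const_left[OF der] ore_extension_def)
qed

lemma ore_subst_add: "ore_subst \<delta> \<sigma> w (u + v) = ore_subst \<delta> \<sigma> w u + ore_subst \<delta> \<sigma> w v"
proof -
  let ?n = "max (degree u) (degree v)"
  have "degree (u + v) \<le> ?n" by (rule degree_add_le_max)
  then show ?thesis
    by (simp add: ore_subst_bound[of _ ?n] smult_add_left \<sigma>_add sum.distrib)
qed

lemma ore_subst_smult: "ore_subst \<delta> \<sigma> w (smult a u) = smult (\<sigma> a) (ore_subst \<delta> \<sigma> w u)"
  by (simp add: ore_subst_bound[of _ "degree u"] degree_smult_le smult_sum_right[OF der] \<sigma>_mult)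

text \<open>\<open>pCons a u\<close> stands for a + u y, as right multiplication by y only shifts
  coefficients. This Horner form drives the inductions below.\<close>

lemma ore_subst_pCons:
  "ore_subst \<delta> \<sigma> w (pCons a u) = [:\<sigma> a:] + ore_mult \<delta> (ore_subst \<delta> \<sigma> w u) w"
proof -
  interpret ring "ore_extension \<delta>" by (rule ring_ore_extension[OF der])
  have s: "ore_mult \<delta> (sum g A) w = (\<Sum>i\<in>A. ore_mult \<delta> (g i) w)" for g :: "nat \<Rightarrow> 'r poly" and A
    by (induction A rule: infinite_finite_induct)
      (simp_all add: ore_mult_0_left[OF der] ore_mult_add_left[OF der])
  have "ore_subst \<delta> \<sigma> w (pCons a u) =
      (\<Sum>i\<le>Suc (degree u). smult (\<sigma> (coeff (pCons a u) i)) (w [^]\<^bsub>ore_extension \<delta>\<^esub> i))"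
    by (rule ore_subst_bound) (rule degree_pCons_le)
  also have "\<dots> = [:\<sigma> a:] + (\<Sum>i\<le>degree u. smult (\<sigma> (coeff u i)) (w [^]\<^bsub>ore_extension \<delta>\<^esub> Suc i))"
    unfolding sum.atMost_Suc_shift by (simp add: ore_extension_def nat_pow_def)
  also have "(\<Sum>i\<le>degree u. smult (\<sigma> (coeff u i)) (w [^]\<^bsub>ore_extension \<delta>\<^esub> Suc i)) =
      ore_mult \<delta> (ore_subst \<delta> \<sigma> w u) w"
    unfolding ore_subst_bound[OF order_refl] s nat_pow_Suc
    by (simp add: ore_mult_smult_left[OF der]) (simp add: ore_extension_def)
  finally show ?thesis .
qed

lemma ore_subst_0: "ore_subst \<delta> \<sigma> w 0 = 0"
  using ore_subst_add[of 0 0] by simp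

text \<open>Rests on y (b + v y) = \<delta>(b) + b y + (y v) y. The term y b is carried over by
  \<open>comm\<close>, the image of the relation y b = b y + \<delta>(b).\<close>

lemma ore_subst_y_times: "ore_subst \<delta> \<sigma> w (ore_y_times \<delta> v) = ore_mult \<delta> w (ore_subst \<delta> \<sigma> w v)"
proof (induction v)
  case 0
  then show ?case
    using ore_mult_add_right[OF der, of w 0 0] by (simp add: ore_y_times_0[OF der] ore_subst_0)
next
  case (pCons b v)
  have y: "ore_y_times \<delta> (pCons b v) = [:\<delta> b:] + (pCons 0 [:b:] + pCons 0 (ore_y_times \<delta> v))"
    by (simp add: ore_y_times_def map_poly_derivation_pCons[OF der])
  have \<sigma>0: "\<sigma> 0 = 0" using \<sigma>_add[of 0 0] by simp
  show ?case
    unfolding y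
    by (simp add: ore_subst_add ore_subst_pCons ore_subst_const[OF der] pCons.IH \<sigma>0
        ore_mult_add_right[OF der] ore_mult_add_left[OF der] comm
        ore_mult_const_left[OF der] ore_mult_assoc[OF der] add_ac del: pCons_0_0)
qed

text \<open>The multiplicative half of the universal property of the Ore extension. Induction on
  \<open>u\<close> reduces it to left factors that are constants or y.\<close>

lemma ore_subst_mult:
  "ore_subst \<delta> \<sigma> w (ore_mult \<delta> u v) = ore_mult \<delta> (ore_subst \<delta> \<sigma> w u) (ore_subst \<delta> \<sigma> w v)"
proof (induction u arbitrary: v)
  case 0
  then show ?case by (simp add: ore_mult_0_left[OF der] ore_subst_0)
next
  case (pCons a u)
  then show ?case
    by (simp add: ore_mult_pCons[OF der] ore_subst_add ore_subst_smult ore_subst_pCons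
        ore_subst_y_times ore_mult_add_left[OF der] ore_mult_const_left[OF der]
        ore_mult_assoc[OF der] ore_mult_0_left[OF der])
qed

end

section \<open>Endomorphisms of \<open>\<Lambda>(f)\<close>\<close>

text \<open>Bijectivity is left out so that \<open>s_aut\<close> and \<open>eigen_embed\<close> can
  be handled before they are known to be invertible. Preservation of 1 is the case c = 1 of the last
  clause.\<close>

definition Lambda_endo ::
  "'a::field_char_0 poly \<Rightarrow> ('a poly poly \<Rightarrow> 'a poly poly) \<Rightarrow> bool" where
  "Lambda_endo f \<phi> \<longleftrightarrow> (\<forall>u v. \<phi> (u + v) = \<phi> u + \<phi> v) \<and>
     (\<forall>u v. \<phi> (ore_mult (f_ddx f) u v) = ore_mult (f_ddx f) (\<phi> u) (\<phi> v)) \<and>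
     (\<forall>c. \<phi> [:[:c:]:] = [:[:c:]:])"

lemma Lambda_endo_id: "Lambda_endo f id"
  by (simp add: Lambda_endo_def)

lemma Lambda_endo_comp: "Lambda_endo f \<phi> \<Longrightarrow> Lambda_endo f \<psi> \<Longrightarrow> Lambda_endo f (\<phi> \<circ> \<psi>)"
  by (simp add: Lambda_endo_def)

lemma Lambda_endo_inv:
  assumes "Lambda_endo f \<phi>" "bij \<phi>"
  shows "Lambda_endo f (inv_into UNIV \<phi>)"
proof -
  have s: "\<phi> (inv_into UNIV \<phi> u) = u" and i: "inv_into UNIV \<phi> (\<phi> u) = u" for u
    using assms(2) by (simp_all add: bij_is_surj surj_f_inv_f bij_is_inj)
  show ?thesis
    using assms(1) unfolding Lambda_endo_def by (metis s i)
qed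

context
  fixes f :: "'a::field_char_0 poly" and \<phi> :: "'a poly poly \<Rightarrow> 'a poly poly"
  assumes endo: "Lambda_endo f \<phi>"
begin

lemma endo_add: "\<phi> (u + v) = \<phi> u + \<phi> v"
  and endo_mult: "\<phi> (ore_mult (f_ddx f) u v) = ore_mult (f_ddx f) (\<phi> u) (\<phi> v)"
  and endo_const: "\<phi> [:[:c:]:] = [:[:c:]:]"
  using endo by (auto simp: Lambda_endo_def)

lemma endo_0: "\<phi> 0 = 0"
  using endo_add[of 0 0] by simp

lemma endo_diff: "\<phi> (u - v) = \<phi> u - \<phi> v"
  using endo_add[of "u - v" v] by simp

lemma endo_1: "\<phi> 1 = 1"
  using endo_const[of 1] by (simp add: one_pCons)

lemma endo_smult: "\<phi> (smult a u) = ore_mult (f_ddx f) (\<phi> [:a:]) (\<phi> u)"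
  using endo_mult[of "[:a:]" u] by (simp add: ore_mult_const_left[OF derivation_f_ddx])

lemma endo_smult_scalar: "\<phi> (smult [:c:] u) = smult [:c:] (\<phi> u)"
  by (simp add: endo_smult endo_const ore_mult_const_left[OF derivation_f_ddx])

lemma endo_pCons: "\<phi> (pCons a u) = \<phi> [:a:] + ore_mult (f_ddx f) (\<phi> u) (\<phi> ore_y)"
proof -
  have "pCons a u = [:a:] + ore_mult (f_ddx f) u ore_y"
    by (simp add: ore_mult_y_right[OF derivation_f_ddx])
  then show ?thesis by (simp add: endo_add endo_mult)
qed

lemma endo_const_pCons:
  "\<phi> [:pCons c a:] = [:[:c:]:] + ore_mult (f_ddx f) (\<phi> [:gen_x:]) (\<phi> [:a:])"
proof -
  have "[:pCons c a:] = [:[:c:]:] + smult gen_x [:a:]" by simp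
  then show ?thesis by (simp only: endo_add endo_smult endo_const)
qed

text \<open>Inside K[x] the product of \<Lambda>(f) is the ordinary one, so Horner's scheme
  evaluates at \<open>g\<close>.\<close>

lemma endo_const_pcompose:
  assumes "\<phi> [:gen_x:] = [:g:]"
  shows "\<phi> [:a:] = [:pcompose a g:]"
proof (induction a)
  case (pCons c a)
  then show ?case
    using endo_const_pCons[of c a]
    by (simp add: assms pcompose_pCons ore_mult_const_left[OF derivation_f_ddx])
qed (simp add: endo_0)

lemma endo_f: "ore_mult (f_ddx f) (\<phi> ore_y) (\<phi> [:gen_x:])
    - ore_mult (f_ddx f) (\<phi> [:gen_x:]) (\<phi> ore_y) = \<phi> [:f:]"
  using arg_cong[OF Lambda_relation[of f], of \<phi>]
  by (simp add: Lambda_def ore_extension_def endo_mult endo_diff)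

lemma endo_f_dvd: obtains u where "\<phi> [:f:] = smult f u"
proof -
  obtain u where "ore_mult (f_ddx f) (\<phi> ore_y) (\<phi> [:gen_x:])
      - ore_mult (f_ddx f) (\<phi> [:gen_x:]) (\<phi> ore_y) = smult f u"
    by (rule ore_commutator_dvd[OF derivation_f_ddx, of f f]) (simp add: f_ddx_def)
  then show thesis using endo_f that by simp
qed

text \<open>Horner's scheme in a domain: each step multiplies by \<phi>(x), adding its degree in y,
  and then adds a scalar, which leaves that degree unchanged. Injectivity keeps the factors
  nonzero.\<close>

lemma endo_degree:
  assumes "inj \<phi>" "a \<noteq> 0"
  shows "degree (\<phi> [:a:]) = degree a * degree (\<phi> [:gen_x:])"
  using assms(2)
proof (induction a)
  case (pCons c a)
  have nz: "\<phi> u \<noteq> 0" if "u \<noteq> 0" for u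
    using that assms(1) endo_0 by (metis injD)
  show ?case
  proof (cases "a = 0")
    case True
    then show ?thesis by (simp add: endo_const)
  next
    case False
    let ?m = "ore_mult (f_ddx f) (\<phi> [:gen_x:]) (\<phi> [:a:])"
    have m: "degree ?m = degree (\<phi> [:gen_x:]) + degree a * degree (\<phi> [:gen_x:])"
      using degree_ore_mult(2)[OF derivation_f_ddx nz nz] False pCons.IH by simp
    have "degree ([:[:c:]:] + ?m) = degree ?m"
    proof (cases "degree ?m = 0")
      case True
      then obtain b where "?m = [:b:]" by (rule degree_eq_zeroE)
      then show ?thesis by simp
    next
      case False
      then show ?thesis by (intro degree_add_eq_right) simp
    qed
    then show ?thesis using m False by (simp add: endo_const_pCons[of c a])
  qed
qed simp

end

lemma Lambda_endo_eqI:
  assumes "Lambda_endo f \<phi>" "Lambda_endo f \<psi>"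
    and "\<phi> [:gen_x:] = \<psi> [:gen_x:]" "\<phi> ore_y = \<psi> ore_y"
  shows "\<phi> = \<psi>"
proof
  fix u
  have c: "\<phi> [:a:] = \<psi> [:a:]" for a
  proof (induction a)
    case (pCons c a)
    then show ?case
      using endo_const_pCons[OF assms(1), of c a] endo_const_pCons[OF assms(2), of c a] assms(3)
      by simp
  qed (simp add: endo_0[OF assms(1)] endo_0[OF assms(2)])
  show "\<phi> u = \<psi> u"
  proof (induction u)
    case (pCons a u)
    then show ?case
      using endo_pCons[OF assms(1), of a u] endo_pCons[OF assms(2), of a u] assms(4) c[of a]
      by simp
  qed (simp add: endo_0[OF assms(1)] endo_0[OF assms(2)])
qed

lemma carrier_Aut_Lambda: "carrier (Aut_Lambda f) = {\<phi>. Lambda_endo f \<phi> \<and> bij \<phi>}"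
proof -
  have "\<phi> \<in> carrier (Aut_Lambda f) \<longleftrightarrow> Lambda_endo f \<phi> \<and> \<phi> 1 = 1 \<and> bij \<phi>" for \<phi>
    by (auto simp: Aut_Lambda_def alg_AutoGroup_def alg_auto_def Lambda_def ore_extension_def
        ring_hom_def Bij_def Lambda_endo_def)
  then show ?thesis using endo_1 by blast
qed

section \<open>The structure of automorphisms\<close>

lemma auto_f:
  assumes "Lambda_endo f \<phi>" "bij \<phi>" "f \<noteq> 0"
  obtains c where "\<phi> [:f:] = [:smult c f:]"
proof -
  let ?\<delta> = "f_ddx f"
  note der = derivation_f_ddx[of f]
  obtain u where u: "\<phi> [:f:] = smult f u" by (rule endo_f_dvd[OF assms(1)])
  obtain v where v: "inv_into UNIV \<phi> [:f:] = smult f v"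
    by (rule endo_f_dvd[OF Lambda_endo_inv[OF assms(1,2)]])
  \<comment> \<open>Applying \<phi> to the preimage f v of f gives f = f u \<phi>(v), and f
    cancels.\<close>
  have "[:f:] = \<phi> (smult f v)"
    using v assms(2) by (metis bij_inv_eq_iff)
  also have "\<dots> = smult f (ore_mult ?\<delta> u (\<phi> v))"
    by (simp add: endo_smult[OF assms(1)] u ore_mult_smult_left[OF der])
  finally have "smult f (1 - ore_mult ?\<delta> u (\<phi> v)) = 0" by (simp add: smult_diff_right)
  then have one: "ore_mult ?\<delta> u (\<phi> v) = 1"
    using assms(3) by simp
  then have nz: "u \<noteq> 0" "\<phi> v \<noteq> 0"
    using ore_mult_add_right[OF der, of u 0 0] by (auto simp: ore_mult_0_left[OF der])
  \<comment> \<open>The degree in y first puts \<open>u\<close> into K[x]; being a unit there, it is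
    then a scalar.\<close>
  then have "degree u + degree (\<phi> v) = 0"
    using degree_ore_mult(2)[OF der nz] one by simp
  then obtain a b where ab: "u = [:a:]" "\<phi> v = [:b:]"
    by (auto elim!: degree_eq_zeroE)
  then have "a * b = 1"
    using one by (simp add: ore_mult_const_left[OF der] one_pCons)
  then have "degree a = 0"
    using is_unit_iff_degree[of a] dvdI[of 1 a b] by (cases "a = 0") auto
  then obtain c where "a = [:c:]" by (rule degree_eq_zeroE)
  then show thesis using that u ab by simp
qed

text \<open>By \<open>endo_degree\<close> the degree of \<phi>(f) in y is \<open>degree f\<close>
  times that of \<phi>(x), while \<open>auto_f\<close> makes it 0.\<close>

lemma auto_gen_x:
  assumes "Lambda_endo f \<phi>" "bij \<phi>" "degree f \<ge> 1"
  obtains g where "\<phi> [:gen_x:] = [:g:]"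
proof -
  have "f \<noteq> 0" using assms(3) by auto
  then obtain c where "\<phi> [:f:] = [:smult c f:]"
    using auto_f[OF assms(1,2)] by blast
  then have "degree f * degree (\<phi> [:gen_x:]) = 0"
    using endo_degree[OF assms(1) bij_is_inj[OF assms(2)] \<open>f \<noteq> 0\<close>] by simp
  then have "degree (\<phi> [:gen_x:]) = 0" using assms(3) by simp
  then show thesis using that by (metis degree_eq_zeroE)
qed

text \<open>A normal form on the generators, from which the descriptions of both subgroups and the
  factorisation of an automorphism are read off.\<close>

lemma auto_structure:
  assumes "Lambda_endo f \<phi>" "bij \<phi>" "lead_coeff f = 1" "degree f \<ge> 1"
  obtains lam mu b where "lam \<noteq> 0" "\<phi> [:gen_x:] = [:[:mu, lam:]:]"
    "pcompose f [:mu, lam:] = smult (lam ^ degree f) f"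
    "\<phi> ore_y = [:b, [:lam ^ (degree f - 1):]:]"
proof -
  let ?\<delta> = "f_ddx f"
  note der = derivation_f_ddx[of f]
  have f0: "f \<noteq> 0" using assms(4) by auto
  obtain g where g: "\<phi> [:gen_x:] = [:g:]" by (rule auto_gen_x[OF assms(1,2,4)])
  have inv: "Lambda_endo f (inv_into UNIV \<phi>)" "bij (inv_into UNIV \<phi>)"
    using Lambda_endo_inv[OF assms(1,2)] bij_imp_bij_inv[OF assms(2)] .
  obtain h where h: "inv_into UNIV \<phi> [:gen_x:] = [:h:]" by (rule auto_gen_x[OF inv assms(4)])
  have "[:gen_x:] = \<phi> [:h:]"
    using h assms(2) by (metis bij_inv_eq_iff)
  \<comment> \<open>The preimage \<open>h\<close> of x also lies in K[x], so x = h(g) and the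
    degrees multiply to 1.\<close>
  then have "gen_x = pcompose h g"
    by (simp add: endo_const_pcompose[OF assms(1) g])
  then have "degree h * degree g = 1"
    by (metis degree_pcompose degree_pCons_eq_if one_neq_zero degree_0 pCons_eq_0_iff One_nat_def)
  then have "degree g = 1" by simp
  then obtain mu lam where gl: "g = [:mu, lam:]" and l: "lam \<noteq> 0"
    by (metis degree1_coeffs)
  obtain c where c: "\<phi> [:f:] = [:smult c f:]" using auto_f[OF assms(1,2) f0] .
  then have fc: "pcompose f g = smult c f"
    by (simp add: endo_const_pcompose[OF assms(1) g])
  \<comment> \<open>f is monic, so \<open>c\<close> is the leading coefficient of f(lam x +
    mu).\<close>
  then have "lead_coeff (pcompose f g) = c"
    using assms(3) by simp
  then have cl: "c = lam ^ degree f"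
    using lead_coeff_comp[of g f] assms(3) gl l by simp
  let ?w = "\<phi> ore_y"
  have com: "ore_mult ?\<delta> ?w [:g:] - smult g ?w = [:smult c f:]"
    using endo_f[OF assms(1)] by (simp add: g c ore_mult_const_left[OF der])
  \<comment> \<open>If \<phi>(y) were in K[x], it would commute with \<open>g\<close>, but the
    commutator c f is nonzero.\<close>
  have "degree ?w \<noteq> 0"
  proof
    assume "degree ?w = 0"
    then obtain a where "?w = [:a:]" by (rule degree_eq_zeroE)
    then show False using com f0 cl l by (simp add: ore_mult_const_left[OF der] mult.commute)
  qed
  then obtain n where n: "degree ?w = Suc n" by (metis not0_implies_Suc)
  \<comment> \<open>The commutator has degree 0 in y, yet its coefficient at \<open>n\<close> is (n
    + 1) lam f times the top coefficient of \<phi>(y), nonzero in characteristic zero. Hence n =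
    0.\<close>
  have eq: "coeff [:smult c f:] n = of_nat (Suc n) * coeff ?w (Suc n) * (f * [:lam:])"
    using ore_mult_const_right_degree_coeff(2)[OF der eq_refl[OF n], of g]
    unfolding com by (simp add: f_ddx_def gl pderiv_pCons)
  have "coeff ?w (Suc n) \<noteq> 0" using n by (metis degree_0 leading_coeff_0_iff nat.distinct(1))
  then have "of_nat (Suc n) * coeff ?w (Suc n) * (f * [:lam:]) \<noteq> 0"
    using f0 l of_nat_eq_0_iff[where 'a = "'a poly", of "Suc n"] by (simp del: of_nat_Suc)
  then have n0: "n = 0" using eq by (cases n) auto
  have "f * [:c:] = f * (coeff ?w 1 * [:lam:])"
    using eq n0 by (simp add: algebra_simps)
  then have "[:c:] = coeff ?w 1 * [:lam:]" using f0 by (metis mult_left_cancel)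
  moreover have "c = lam ^ (degree f - 1) * lam"
    using assms(4) unfolding cl by (metis power_minus_mult zero_less_one less_le_trans)
  ultimately have "[:lam ^ (degree f - 1):] * [:lam:] = coeff ?w 1 * [:lam:]" by (simp add: mult.commute)
  then have "coeff ?w 1 = [:lam ^ (degree f - 1):]"
    using l by (metis mult_right_cancel pCons_eq_0_iff)
  then have "?w = [:coeff ?w 0, [:lam ^ (degree f - 1):]:]"
    using n n0 by (intro poly_eqI) (auto simp: coeff_pCons coeff_eq_0 split: nat.split)
  then show thesis using that[OF l] g gl fc cl by metis
qed

section \<open>The subgroups \<open>\<S>(K)\<close> and \<open>G\<^sub>f(K)\<close>\<close>

text \<open>Two-sided invertibility needs checking only on x and y, by
  \<open>Lambda_endo_eqI\<close>.\<close>

lemma bij_Lambda_endo: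
  assumes "Lambda_endo f \<phi>" "Lambda_endo f \<psi>"
    and "\<phi> (\<psi> [:gen_x:]) = [:gen_x:]" "\<phi> (\<psi> ore_y) = ore_y"
    and "\<psi> (\<phi> [:gen_x:]) = [:gen_x:]" "\<psi> (\<phi> ore_y) = ore_y"
  shows "bij \<phi>"
proof (rule o_bij)
  show "\<psi> \<circ> \<phi> = id" "\<phi> \<circ> \<psi> = id"
    using assms by (auto intro!: Lambda_endo_eqI[of f] Lambda_endo_comp Lambda_endo_id)
qed

text \<open>The element y + p satisfies the same relation as y because p commutes with K[x].\<close>

lemma Lambda_endo_s_aut: "Lambda_endo f (s_aut f p)"
proof -
  note der = derivation_f_ddx[of f]
  have "ore_mult (f_ddx f) (ore_y + [:p:]) [:a:] = smult a (ore_y + [:p:]) + [:f_ddx f a:]" for a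
    by (simp add: ore_mult_add_left[OF der] ore_mult_y_left[OF der] ore_mult_const_left[OF der]
        ore_y_times_def map_poly_derivation_pCons[OF der])
      (simp add: ore_y_def algebra_simps)
  then show ?thesis
    unfolding Lambda_endo_def s_aut_def
    by (auto simp: ore_subst_const[OF der] ore_subst_add[OF der] ore_subst_mult[OF der])
qed

lemma s_aut_Aut: "s_aut f p \<in> carrier (Aut_Lambda f)"
proof -
  \<comment> \<open>The inverse is \<open>s_aut f (- p)\<close>; taking q = p and q = -p covers both
    orders of composition.\<close>
  have "s_aut f q (s_aut f (- q) ore_y) = ore_y" for q
    using endo_const_pcompose[OF Lambda_endo_s_aut s_aut_generators(1), of f q "- q"]
    by (simp add: s_aut_generators endo_add[OF Lambda_endo_s_aut] del: minus_pCons)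
  from this[of p] this[of "- p"] show ?thesis
    by (auto simp: carrier_Aut_Lambda Lambda_endo_s_aut s_aut_generators
        intro!: bij_Lambda_endo[where f = f and \<psi> = "s_aut f (- p)"])
qed

text \<open>Fixing x forces lam = 1 in \<open>auto_structure\<close>, so y goes to y + b. In this
  form closure under the group operations is immediate.\<close>

lemma S_group_eq:
  assumes "lead_coeff f = 1" "degree f \<ge> 1"
  shows "S_group f = {\<phi> \<in> carrier (Aut_Lambda f). \<phi> [:gen_x:] = [:gen_x:]}"
proof (intro equalityI subsetI)
  fix \<phi> assume "\<phi> \<in> {\<phi> \<in> carrier (Aut_Lambda f). \<phi> [:gen_x:] = [:gen_x:]}"
  then have \<phi>: "Lambda_endo f \<phi>" "bij \<phi>" "\<phi> [:gen_x:] = [:gen_x:]"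
    by (auto simp: carrier_Aut_Lambda)
  obtain lam mu b where "\<phi> [:gen_x:] = [:[:mu, lam:]:]"
    "\<phi> ore_y = [:b, [:lam ^ (degree f - 1):]:]"
    by (rule auto_structure[OF \<phi>(1,2) assms])
  then have "\<phi> ore_y = s_aut f b ore_y"
    using \<phi>(3) unfolding s_aut_generators by (simp add: ore_y_def one_pCons)
  then have "\<phi> = s_aut f b"
    using \<phi> by (intro Lambda_endo_eqI[OF \<phi>(1) Lambda_endo_s_aut]) (simp_all add: s_aut_generators)
  then show "\<phi> \<in> S_group f" by (simp add: S_group_def)
qed (auto simp: S_group_def s_aut_Aut s_aut_generators)

text \<open>Comparing leading coefficients determines the eigenvalue.\<close>

lemma eigengroup_iff:
  assumes "lead_coeff f = 1"
  shows "\<sigma> \<in> eigengroup f \<longleftrightarrow> (\<exists>lam mu. lam \<noteq> 0 \<and> \<sigma> = sigma_aut lam mu \<and>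
    sigma_aut lam mu f = smult (lam ^ degree f) f)"
proof -
  have "c = lam ^ degree f" if "lam \<noteq> 0" "sigma_aut lam mu f = smult c f" for lam mu c
    using arg_cong[OF that(2), of lead_coeff] lead_coeff_comp[of "[:mu, lam:]" f] assms that(1)
    by (simp add: sigma_aut_def)
  then show ?thesis
    unfolding eigengroup_def carrier_Aut_poly by fast
qed

text \<open>With d = deg f, the chain rule and \<sigma>(f) = lam^d f give lam^(d-1) f (\<sigma> a)'
  = lam^d f \<sigma>(a') = \<sigma>(f a'), which is the relation needed for lam^(d-1) y.\<close>

lemma Lambda_endo_eigen_embed:
  assumes "lead_coeff f = 1" "degree f \<ge> 1" "\<sigma> \<in> eigengroup f"
  shows "Lambda_endo f (eigen_embed f \<sigma>)"
proof -
  note der = derivation_f_ddx[of f]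
  obtain lam mu where \<sigma>: "\<sigma> = sigma_aut lam mu" and f: "\<sigma> f = smult (lam ^ degree f) f"
    using assms(3) unfolding eigengroup_iff[OF assms(1)] by blast
  let ?w = "smult [:lam ^ (degree f - 1):] ore_y"
  have hom: "\<sigma> (a + b) = \<sigma> a + \<sigma> b" "\<sigma> (a * b) = \<sigma> a * \<sigma> b" for a b
    by (simp_all add: \<sigma> sigma_aut_def pcompose_add pcompose_mult)
  have l: "lam ^ (degree f - 1) * lam = lam ^ degree f"
    using assms(2) by (metis power_minus_mult zero_less_one less_le_trans)
  have d: "pderiv (\<sigma> a) = smult lam (\<sigma> (pderiv a))" for a
    by (simp add: \<sigma> sigma_aut_def pderiv_pcompose pderiv_pCons)
  have "smult (lam ^ (degree f - 1)) (f * pderiv (\<sigma> a)) = \<sigma> (f_ddx f a)" for a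
    unfolding f_ddx_def hom f d mult_smult_left mult_smult_right smult_smult l ..
  then have "ore_mult (f_ddx f) ?w [:\<sigma> a:] = smult (\<sigma> a) ?w + [:\<sigma> (f_ddx f a):]" for a
    by (simp add: ore_mult_smult_left[OF der] ore_mult_y_left[OF der]
        ore_y_times_def map_poly_derivation_pCons[OF der])
      (simp add: ore_y_def f_ddx_def)
  moreover have "eigen_embed f \<sigma> = ore_subst (f_ddx f) \<sigma> ?w"
    by (simp add: eigen_embed_def \<sigma> sigma_aut_def pcompose_pCons)
  moreover have "\<sigma> [:c:] = [:c:]" for c by (simp add: \<sigma> sigma_aut_def)
  ultimately show ?thesis
    unfolding Lambda_endo_def
    by (auto simp: ore_subst_const[OF der] ore_subst_add[OF der] ore_subst_mult[OF der] hom)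
qed

text \<open>The inverse is the embedding of the inverse of \<sigma>, which again lies in the
  eigengroup.\<close>

lemma eigen_embed_Aut:
  assumes "lead_coeff f = 1" "degree f \<ge> 1" "\<sigma> \<in> eigengroup f"
  shows "eigen_embed f \<sigma> \<in> carrier (Aut_Lambda f)"
proof -
  \<comment> \<open>The two equations on the parameters say that lam' (lam x + mu) + mu' = x. Both
    orders of composition are instances.\<close>
  have emb: "eigen_embed f (sigma_aut lam mu) (eigen_embed f (sigma_aut lam' mu') [:gen_x:]) = [:gen_x:]"
      "eigen_embed f (sigma_aut lam mu) (eigen_embed f (sigma_aut lam' mu') ore_y) = ore_y"
    if "sigma_aut lam mu \<in> eigengroup f" "lam * lam' = 1" "mu' + mu * lam' = 0" for lam mu lam' mu'
  proof -
    note endo = Lambda_endo_eigen_embed[OF assms(1,2) that(1)]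
    note c = endo_const_pcompose[OF endo eigen_embed_sigma_generators(1)]
    show "eigen_embed f (sigma_aut lam mu) (eigen_embed f (sigma_aut lam' mu') [:gen_x:]) = [:gen_x:]"
      using that by (simp add: eigen_embed_sigma_generators c pcompose_pCons mult.commute)
    have "lam ^ (degree f - 1) * lam' ^ (degree f - 1) = 1"
      using that(2) by (metis power_mult_distrib power_one)
    then have "[:lam' ^ (degree f - 1):] * [:lam ^ (degree f - 1):] = 1"
      by (simp add: one_pCons)
    then show "eigen_embed f (sigma_aut lam mu) (eigen_embed f (sigma_aut lam' mu') ore_y) = ore_y"
      unfolding eigen_embed_sigma_generators endo_smult_scalar[OF endo] smult_smult
      by (simp only: smult_1_left)
  qed
  obtain lam mu where l: "lam \<noteq> 0" and \<sigma>: "\<sigma> = sigma_aut lam mu"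
    and f: "sigma_aut lam mu f = smult (lam ^ degree f) f"
    using assms(3) unfolding eigengroup_iff[OF assms(1)] by blast
  \<comment> \<open>Applying the inverse substitution to the eigenvalue equation shows that it has
    eigenvalue lam^(-d), where d = deg f.\<close>
  have "f = smult (lam ^ degree f) (sigma_aut (1 / lam) (- mu / lam) f)"
    using arg_cong[OF f, of "sigma_aut (1 / lam) (- mu / lam)"] sigma_aut_inverse(2)[OF l]
    by (simp add: sigma_aut_def pcompose_smult)
  then have "smult ((1 / lam) ^ degree f) f = smult ((1 / lam) ^ degree f * lam ^ degree f)
      (sigma_aut (1 / lam) (- mu / lam) f)"
    by (metis smult_smult)
  then have "smult ((1 / lam) ^ degree f) f = sigma_aut (1 / lam) (- mu / lam) f"
    using l by (simp flip: power_mult_distrib)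
  then have \<sigma>': "sigma_aut (1 / lam) (- mu / lam) \<in> eigengroup f"
    unfolding eigengroup_iff[OF assms(1)] using l
    by (intro exI[of _ "1 / lam"] exI[of _ "- mu / lam"]) auto
  have "bij (eigen_embed f \<sigma>)"
    unfolding \<sigma> using assms(3) \<sigma>' l
    by (intro bij_Lambda_endo[of f _ "eigen_embed f (sigma_aut (1 / lam) (- mu / lam))"]
        Lambda_endo_eigen_embed emb assms(1,2)) (auto simp: \<sigma> field_simps)
  then show ?thesis
    using Lambda_endo_eigen_embed[OF assms] by (simp add: carrier_Aut_Lambda)
qed

lemma sigma_aut_in_eigengroup:
  assumes "lam \<noteq> 0" "pcompose f [:mu, lam:] = smult (lam ^ degree f) f"
  shows "sigma_aut lam mu \<in> eigengroup f"
  using assms by (auto simp: eigengroup_def carrier_Aut_poly sigma_aut_def)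

text \<open>The condition on y removes the term \<open>b\<close> in \<open>auto_structure\<close>,
  so \<phi> agrees on the generators with an embedded element of the eigengroup.\<close>

lemma G_group_eq:
  assumes "lead_coeff f = 1" "degree f \<ge> 1"
  shows "G_group f = {\<phi> \<in> carrier (Aut_Lambda f). \<exists>c. \<phi> ore_y = smult [:c:] ore_y}"
proof (intro equalityI subsetI)
  fix \<phi> assume "\<phi> \<in> {\<phi> \<in> carrier (Aut_Lambda f). \<exists>c. \<phi> ore_y = smult [:c:] ore_y}"
  then obtain c where \<phi>: "Lambda_endo f \<phi>" "bij \<phi>" "\<phi> ore_y = smult [:c:] ore_y"
    by (auto simp: carrier_Aut_Lambda)
  obtain lam mu b where *: "lam \<noteq> 0" "\<phi> [:gen_x:] = [:[:mu, lam:]:]"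
    "pcompose f [:mu, lam:] = smult (lam ^ degree f) f"
    "\<phi> ore_y = [:b, [:lam ^ (degree f - 1):]:]"
    by (rule auto_structure[OF \<phi>(1,2) assms])
  then have e: "sigma_aut lam mu \<in> eigengroup f" by (intro sigma_aut_in_eigengroup)
  have "\<phi> = eigen_embed f (sigma_aut lam mu)"
  proof (rule Lambda_endo_eqI[OF \<phi>(1) Lambda_endo_eigen_embed[OF assms e]])
    show "\<phi> ore_y = eigen_embed f (sigma_aut lam mu) ore_y"
      using \<phi>(3) *(4) unfolding eigen_embed_sigma_generators by (simp add: ore_y_def)
  qed (simp add: *(2) eigen_embed_sigma_generators)
  then show "\<phi> \<in> G_group f" using e by (simp add: G_group_def)
next
  fix \<phi> assume "\<phi> \<in> G_group f"
  then obtain \<sigma> where \<sigma>: "\<sigma> \<in> eigengroup f" "\<phi> = eigen_embed f \<sigma>" by (auto simp: G_group_def)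
  moreover from \<sigma>(1) obtain lam mu where "\<sigma> = sigma_aut lam mu"
    unfolding eigengroup_iff[OF assms(1)] by blast
  ultimately show "\<phi> \<in> {\<phi> \<in> carrier (Aut_Lambda f). \<exists>c. \<phi> ore_y = smult [:c:] ore_y}"
    using eigen_embed_Aut[OF assms \<sigma>(1)] by (auto simp: eigen_embed_sigma_generators)
qed

section \<open>Group operations of \<open>Aut_Lambda f\<close> as operations on functions\<close>

lemma one_Aut_Lambda: "\<one>\<^bsub>Aut_Lambda f\<^esub> = id"
  by (auto simp: Aut_Lambda_def alg_AutoGroup_def BijGroup_def Lambda_def ore_extension_def)

text \<open>\<open>BijGroup\<close> composes with restriction to the carrier, which here is
  \<open>UNIV\<close>.\<close>

lemma mult_Aut_Lambda:
  assumes "\<phi> \<in> carrier (Aut_Lambda f)" "\<psi> \<in> carrier (Aut_Lambda f)"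
  shows "\<phi> \<otimes>\<^bsub>Aut_Lambda f\<^esub> \<psi> = \<phi> \<circ> \<psi>"
  using assms unfolding carrier_Aut_Lambda
  by (auto simp: Aut_Lambda_def alg_AutoGroup_def BijGroup_def Lambda_def ore_extension_def
      Bij_def compose_def)

lemma Aut_Lambda_comp_closed:
  "\<phi> \<in> carrier (Aut_Lambda f) \<Longrightarrow> \<psi> \<in> carrier (Aut_Lambda f) \<Longrightarrow> \<phi> \<circ> \<psi> \<in> carrier (Aut_Lambda f)"
  by (simp add: carrier_Aut_Lambda Lambda_endo_comp bij_comp)

lemma Aut_Lambda_inv_closed:
  "\<phi> \<in> carrier (Aut_Lambda f) \<Longrightarrow> inv_into UNIV \<phi> \<in> carrier (Aut_Lambda f)"
  by (simp add: carrier_Aut_Lambda Lambda_endo_inv bij_imp_bij_inv)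

lemma group_Aut_Lambda: "group (Aut_Lambda f)"
proof (rule groupI)
  fix \<phi> assume \<phi>: "\<phi> \<in> carrier (Aut_Lambda f)"
  then have "inv_into UNIV \<phi> \<circ> \<phi> = id"
    by (simp add: carrier_Aut_Lambda bij_is_inj)
  then show "\<exists>\<psi>\<in>carrier (Aut_Lambda f). \<psi> \<otimes>\<^bsub>Aut_Lambda f\<^esub> \<phi> = \<one>\<^bsub>Aut_Lambda f\<^esub>"
    using \<phi> Aut_Lambda_inv_closed[OF \<phi>]
    by (intro bexI[of _ "inv_into UNIV \<phi>"]) (simp_all add: mult_Aut_Lambda one_Aut_Lambda)
qed (simp_all add: mult_Aut_Lambda one_Aut_Lambda Aut_Lambda_comp_closed comp_assoc
    carrier_Aut_Lambda[THEN eqset_imp_iff, of id] Lambda_endo_id)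

lemma inv_Aut_Lambda:
  assumes "\<phi> \<in> carrier (Aut_Lambda f)"
  shows "inv\<^bsub>Aut_Lambda f\<^esub> \<phi> = inv_into UNIV \<phi>"
proof (rule group.inv_equality[OF group_Aut_Lambda])
  show "inv_into UNIV \<phi> \<otimes>\<^bsub>Aut_Lambda f\<^esub> \<phi> = \<one>\<^bsub>Aut_Lambda f\<^esub>"
    using assms Aut_Lambda_inv_closed[OF assms]
    by (simp add: mult_Aut_Lambda one_Aut_Lambda) (simp add: carrier_Aut_Lambda bij_is_inj)
qed (use assms Aut_Lambda_inv_closed in auto)

theorem theorem1p2:
  fixes f :: "'a::field_char_0 poly"
  assumes "lead_coeff f = 1" and "degree f \<ge> 1"
  shows "semidirect_product (Aut_Lambda f) (S_group f) (G_group f)"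
proof -
  interpret group "Aut_Lambda f" by (rule group_Aut_Lambda)
  note S = S_group_eq[OF assms] and G = G_group_eq[OF assms]
  let ?A = "carrier (Aut_Lambda f)"
  have id: "id \<in> ?A" using one_closed by (simp add: one_Aut_Lambda)
  have app_inv: "inv_into UNIV \<phi> (\<phi> u) = u" "\<phi> (inv_into UNIV \<phi> u) = u" if "\<phi> \<in> ?A" for \<phi> u
    using that by (simp_all add: carrier_Aut_Lambda bij_is_inj bij_is_surj surj_f_inv_f)
  have smult_y: "\<phi> (smult [:c:] ore_y) = smult [:c:] (\<phi> ore_y)" if "\<phi> \<in> ?A" for \<phi> c
    using that endo_smult_scalar by (auto simp: carrier_Aut_Lambda)
  have "subgroup (S_group f) (Aut_Lambda f)"
  proof (rule subgroupI)
    fix \<phi> assume "\<phi> \<in> S_group f"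
    then show "inv\<^bsub>Aut_Lambda f\<^esub> \<phi> \<in> S_group f"
      unfolding S using app_inv(1)[of \<phi> "[:gen_x:]"]
      by (auto simp: inv_Aut_Lambda Aut_Lambda_inv_closed)
  qed (use id in \<open>auto simp: S mult_Aut_Lambda Aut_Lambda_comp_closed\<close>)
  moreover have "\<phi> \<otimes>\<^bsub>Aut_Lambda f\<^esub> s \<otimes>\<^bsub>Aut_Lambda f\<^esub> inv\<^bsub>Aut_Lambda f\<^esub> \<phi> \<in> S_group f"
    if "\<phi> \<in> ?A" "s \<in> S_group f" for \<phi> s
  proof -
    have s: "s \<in> ?A" "Lambda_endo f s" "s [:gen_x:] = [:gen_x:]"
      using that(2) by (auto simp: S carrier_Aut_Lambda)
    have i: "inv_into UNIV \<phi> \<in> ?A" by (rule Aut_Lambda_inv_closed[OF that(1)])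
    then obtain g where g: "inv_into UNIV \<phi> [:gen_x:] = [:g:]"
      using auto_gen_x[OF _ _ assms(2)] unfolding carrier_Aut_Lambda by blast
    \<comment> \<open>Normality: the inverse of \<phi> maps x into K[x], which \<open>s\<close>
      fixes pointwise, so the conjugate fixes x.\<close>
    have "s [:g:] = [:g:]"
      by (simp add: endo_const_pcompose[OF s(2,3)] pcompose_idR)
    then have "\<phi> (s (inv_into UNIV \<phi> [:gen_x:])) = [:gen_x:]"
      using app_inv(2)[OF that(1), of "[:gen_x:]"] g by simp
    then show ?thesis
      using that(1) s(1) i by (simp add: S inv_Aut_Lambda mult_Aut_Lambda Aut_Lambda_comp_closed)
  qed
  ultimately have "S_group f \<lhd> Aut_Lambda f" by (simp add: normal_inv_iff)
  moreover have "subgroup (G_group f) (Aut_Lambda f)"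
  proof (rule subgroupI)
    have "id ore_y = smult [:1:] ore_y" by (simp flip: one_pCons)
    then show "G_group f \<noteq> {}" using id unfolding G by blast
  next
    fix \<phi> assume "\<phi> \<in> G_group f"
    then obtain c where \<phi>: "\<phi> \<in> ?A" "\<phi> ore_y = smult [:c:] ore_y" by (auto simp: G)
    note i = Aut_Lambda_inv_closed[OF \<phi>(1)]
    \<comment> \<open>Applying the inverse to \<phi>(y) = c y shows c to be nonzero and the inverse
      to scale y by 1 / c.\<close>
    have y: "ore_y = smult [:c:] (inv_into UNIV \<phi> ore_y)"
      using app_inv(1)[OF \<phi>(1), of ore_y] smult_y[OF i] \<phi>(2) by simp
    then have "c \<noteq> 0" by (auto simp: ore_y_def)
    then have "inv_into UNIV \<phi> ore_y = smult [:1 / c:] (smult [:c:] (inv_into UNIV \<phi> ore_y))"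
      by (simp flip: one_pCons)
    then show "inv\<^bsub>Aut_Lambda f\<^esub> \<phi> \<in> G_group f"
      using i \<phi>(1) y by (auto simp: G inv_Aut_Lambda)
  next
    fix \<phi> \<psi> assume "\<phi> \<in> G_group f" "\<psi> \<in> G_group f"
    then obtain c d where "\<phi> \<in> ?A" "\<psi> \<in> ?A" "\<phi> ore_y = smult [:c:] ore_y" "\<psi> ore_y = smult [:d:] ore_y"
      by (auto simp: G)
    then have "\<phi> \<circ> \<psi> \<in> ?A" "(\<phi> \<circ> \<psi>) ore_y = smult [:c * d:] ore_y" "\<phi> \<otimes>\<^bsub>Aut_Lambda f\<^esub> \<psi> = \<phi> \<circ> \<psi>"
      by (simp_all add: Aut_Lambda_comp_closed mult_Aut_Lambda smult_y)
    then show "\<phi> \<otimes>\<^bsub>Aut_Lambda f\<^esub> \<psi> \<in> G_group f" unfolding G by auto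
  qed (auto simp: G)
  moreover have "\<phi> \<in> S_group f <#>\<^bsub>Aut_Lambda f\<^esub> G_group f" if "\<phi> \<in> ?A" for \<phi>
  proof -
    have \<phi>: "Lambda_endo f \<phi>" "bij \<phi>" using that by (auto simp: carrier_Aut_Lambda)
    obtain lam mu b where *: "lam \<noteq> 0" "\<phi> [:gen_x:] = [:[:mu, lam:]:]"
      "pcompose f [:mu, lam:] = smult (lam ^ degree f) f"
      "\<phi> ore_y = [:b, [:lam ^ (degree f - 1):]:]"
      by (rule auto_structure[OF \<phi> assms])
    then have e: "sigma_aut lam mu \<in> eigengroup f" by (intro sigma_aut_in_eigengroup)
    define g where "g = eigen_embed f (sigma_aut lam mu)"
    \<comment> \<open>With d = deg f, \<open>s\<close> sends lam^(d-1) y to lam^(d-1) y + lam^(d-1)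
      p, so p = b / lam^(d-1) produces the required term \<open>b\<close>.\<close>
    define s where "s = s_aut f (smult (1 / lam ^ (degree f - 1)) b)"
    have g: "g \<in> G_group f" "g \<in> ?A" "Lambda_endo f g"
      using e eigen_embed_Aut[OF assms e] Lambda_endo_eigen_embed[OF assms e]
      by (auto simp: g_def G_group_def)
    have s: "s \<in> S_group f" "s \<in> ?A" "Lambda_endo f s"
      using s_aut_Aut Lambda_endo_s_aut by (auto simp: s_def S_group_def)
    have "s [:[:mu, lam:]:] = [:[:mu, lam:]:]"
      using endo_const_pcompose[OF s(3), of gen_x] by (simp add: s_def s_aut_generators pcompose_idR)
    moreover have "s (smult [:lam ^ (degree f - 1):] ore_y) = \<phi> ore_y"
      unfolding smult_y[OF s(2)] unfolding s_def s_aut_generators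
      using *(1,4) by (simp add: ore_y_def)
    ultimately have "\<phi> = s \<circ> g"
      using *(2) by (intro Lambda_endo_eqI[OF \<phi>(1) Lambda_endo_comp[OF s(3) g(3)]])
        (simp_all add: g_def eigen_embed_sigma_generators)
    then show ?thesis
      unfolding set_mult_def using s(1) g(1) mult_Aut_Lambda[OF s(2) g(2), symmetric] by blast
  qed
  then have "S_group f <#>\<^bsub>Aut_Lambda f\<^esub> G_group f = ?A"
    by (auto simp: set_mult_def S G)
  moreover have "\<phi> = id" if SG: "\<phi> \<in> S_group f" "\<phi> \<in> G_group f" for \<phi>
  proof -
    obtain c where \<phi>: "Lambda_endo f \<phi>" "bij \<phi>" "\<phi> [:gen_x:] = [:gen_x:]"
      "\<phi> ore_y = smult [:c:] ore_y"
      using SG by (auto simp: S G carrier_Aut_Lambda)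
    obtain lam mu b where "\<phi> [:gen_x:] = [:[:mu, lam:]:]" "\<phi> ore_y = [:b, [:lam ^ (degree f - 1):]:]"
      by (rule auto_structure[OF \<phi>(1,2) assms])
    \<comment> \<open>Fixing x gives lam = 1, and \<phi>(y) = c y gives b = 0.\<close>
    then have "\<phi> ore_y = ore_y" using \<phi>(3,4) by (simp add: ore_y_def one_pCons)
    then show "\<phi> = id" using \<phi>(3) by (intro Lambda_endo_eqI[OF \<phi>(1) Lambda_endo_id]) simp_all
  qed
  then have "S_group f \<inter> G_group f = {\<one>\<^bsub>Aut_Lambda f\<^esub>}"
    using calculation(1,2) by (auto simp: one_Aut_Lambda normal_def dest!: subgroup.one_closed)
  ultimately show ?thesis by (simp add: semidirect_product_def)
qed

end
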